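(* Let $(X,GP)$ be a GP-metric space and define $p_{GP}:X\times X\to[0,\infty)$ by $$p_{GP}(x,y)=GP(x,y,y)\quad\text{for all }x,y\in X.$$ Then $(X,p_{GP})$ is a partial metric space.
   Context: Let $X$ be a non-empty set. A GP-metric on $X$ is a function $GP:X\times X\times X\to[0,\infty)$ such that for all $x,y,z,a\in X$: (GP1) $0\le GP(x,x,x)\le GP(x,x,y)\le GP(x,y,z)$; (GP2) $GP$ is invariant under all permutations of its three arguments; (GP3) $GP(x,y,z)\le GP(x,a,a)+GP(a,y,z)-GP(a,a,a)$; (GP4) $x=y=z$ if $GP(x,y,z)=GP(x,x,x)=GP(y,y,y)=GP(z,z,z)$. The pair $(X,GP)$ is a GP-metric space. A partial metric on $X$ is a function $p:X\times X\to[0,\infty)$ such that for all $x,y,z\in X$: (P1) $x=y$ if and only if $p(x,x)=p(x,y)=p(y,y)$; (P2) $p(x,x)\le p(x,y)$; (P3) $p(x,y)=p(y,x)$; (P4) $p(x,z)\le p(x,y)+p(y,z)-p(y,y)$. The pair $(X,p)$ is a partial metric space. *)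

theory Defs
  imports Complex_Main
begin

text \<open>
  As in the library's locale for metric spaces on a carrier set, the functions are total on the
  ambient type and all conditions are relativised to the carrier \<open>X\<close>; in particular the codomain
  \<open>[0, \<infinity>)\<close> becomes the assumption \<open>nonneg\<close>.
\<close>

locale GP_metric_space =
  fixes X :: "'a set" and GP :: "'a \<Rightarrow> 'a \<Rightarrow> 'a \<Rightarrow> real"
  assumes nonempty: "X \<noteq> {}"
    and nonneg: "\<lbrakk>x \<in> X; y \<in> X; z \<in> X\<rbrakk> \<Longrightarrow> 0 \<le> GP x y z"
    and GP1: "\<lbrakk>x \<in> X; y \<in> X; z \<in> X\<rbrakk> \<Longrightarrow>
      0 \<le> GP x x x \<and> GP x x x \<le> GP x x y \<and> GP x x y \<le> GP x y z"
    and GP2: "\<lbrakk>x \<in> X; y \<in> X; z \<in> X\<rbrakk> \<Longrightarrow>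
      GP x y z = GP x z y \<and> GP x y z = GP y x z \<and> GP x y z = GP y z x \<and>
      GP x y z = GP z x y \<and> GP x y z = GP z y x"
    and GP3: "\<lbrakk>x \<in> X; y \<in> X; z \<in> X; a \<in> X\<rbrakk> \<Longrightarrow>
      GP x y z \<le> GP x a a + GP a y z - GP a a a"
    and GP4: "\<lbrakk>x \<in> X; y \<in> X; z \<in> X;
      GP x y z = GP x x x; GP x x x = GP y y y; GP y y y = GP z z z\<rbrakk> \<Longrightarrow> x = y \<and> y = z"

locale partial_metric_space =
  fixes X :: "'a set" and p :: "'a \<Rightarrow> 'a \<Rightarrow> real"
  assumes nonempty: "X \<noteq> {}"
    and nonneg: "\<lbrakk>x \<in> X; y \<in> X\<rbrakk> \<Longrightarrow> 0 \<le> p x y"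
    and P1: "\<lbrakk>x \<in> X; y \<in> X\<rbrakk> \<Longrightarrow> x = y \<longleftrightarrow> p x x = p x y \<and> p x y = p y y"
    and P2: "\<lbrakk>x \<in> X; y \<in> X\<rbrakk> \<Longrightarrow> p x x \<le> p x y"
    and P3: "\<lbrakk>x \<in> X; y \<in> X\<rbrakk> \<Longrightarrow> p x y = p y x"
    and P4: "\<lbrakk>x \<in> X; y \<in> X; z \<in> X\<rbrakk> \<Longrightarrow> p x z \<le> p x y + p y z - p y y"

definition p_GP :: "('a \<Rightarrow> 'a \<Rightarrow> 'a \<Rightarrow> real) \<Rightarrow> 'a \<Rightarrow> 'a \<Rightarrow> real"
  where "p_GP GP x y = GP x y y"

end

theory Submission
  imports Defs
begin

text \<open>
  The only axiom of a partial metric that is not immediate is symmetry. Since (GP1) imposes no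
  distinctness condition, \<open>z = y\<close> is allowed there and gives \<open>GP(x,x,y) \<le> GP(x,y,y)\<close>; exchanging
  \<open>x\<close> and \<open>y\<close> gives the reverse inequality.
\<close>

lemma (in GP_metric_space) GP_double_swap:
  assumes "x \<in> X" "y \<in> X"
  shows "GP x y y = GP y x x"
proof -
  have "GP x x y \<le> GP x y y" "GP y y x \<le> GP y x x"
    using assms GP1 by blast+
  moreover have "GP x x y = GP y x x" "GP y y x = GP x y y"
    using assms GP2 by blast+
  ultimately show ?thesis by linarith
qed

theorem proposition3p6:
  fixes X :: "'a set" and GP :: "'a \<Rightarrow> 'a \<Rightarrow> 'a \<Rightarrow> real"
  assumes "GP_metric_space X GP"
  shows "partial_metric_space X (p_GP GP)"
proof -
  interpret GP_metric_space X GP by fact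
  show ?thesis
  proof (unfold_locales, unfold p_GP_def)
    show "X \<noteq> {}" by (rule nonempty)
  next
    fix x y assume "x \<in> X" "y \<in> X"
    then show "0 \<le> GP x y y" by (intro nonneg)
  next
    fix x y assume "x \<in> X" "y \<in> X"
    then show "x = y \<longleftrightarrow> GP x x x = GP x y y \<and> GP x y y = GP y y y"
      \<comment> \<open>Only the right-to-left direction has content. At the triple
        \<open>x, y, y\<close> the last equality required by (GP4) is trivial, so the two given
        equalities suffice.\<close>
      using GP4[of x y y] by auto
  next
    fix x y assume "x \<in> X" "y \<in> X"
    then show "GP x x x \<le> GP x y y"
      \<comment> \<open>The chain in (GP1) passes through \<open>GP x x y\<close>.\<close>
      using GP1[of x y y] by linarith
  next
    fix x y assume "x \<in> X" "y \<in> X"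
    then show "GP x y y = GP y x x" by (rule GP_double_swap)
  next
    fix x y z assume "x \<in> X" "y \<in> X" "z \<in> X"
    then show "GP x z z \<le> GP x y y + GP y z z - GP y y y"
      \<comment> \<open>(GP3) at the triple \<open>x, z, z\<close> with intermediate point
        \<open>a = y\<close> is exactly (P4).\<close>
      by (intro GP3)
  qed
qed

end
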